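(* Let $G$ be a finite group and $D\subseteq G$ a strong deficient difference set for $(v_k;\lambda,\mu)$. Then the incidence structure with point set $G$, line set $\mathrm{dev}\,D=\{gD\mid g\in G\}$ and incidence being membership is a strongly regular configuration with parameters $(v_k;\lambda,\mu)$, and $G$ (acting by left multiplication) is an automorphism group of it acting regularly on the points and on the lines. Conversely, every strongly regular configuration with parameters $(v_k;\lambda,\mu)$ admitting an automorphism group $G$ acting regularly on the points and on the lines is obtained in this way from a strong deficient difference set for $(v_k;\lambda,\mu)$ in $G$.
   Context: Let $G$ be a group of order $v$. A subset $D\subseteq G$ with $|D|=k$ is a deficient difference set if the left differences $d_1^{-1}d_2$, $d_1,d_2\in D$, $d_1\ne d_2$, are pairwise distinct. Let $\Delta(D)=\{d_1^{-1}d_2\mid d_1,d_2\in D,\ d_1\ne d_2\}$ and for $x\in G\setminus\{1\}$ let $n(x)=|\Delta(D)\cap x\Delta(D)|$. $D$ is a strong deficient difference set (SDDS) for $(v_k;\lambda,\mu)$ if it is a deficient difference set with $n(x)=\lambda$ for all $x\in\Delta(D)$ and $n(x)=\mu$ for all $x\in G\setminus(\Delta(D)\cup\{1\})$. A symmetric $(v_k)$ configuration is a finite incidence structure of $v$ points and $v$ lines such that every line has exactly $k$ points, every point lies on exactly $k$ lines, and two distinct points lie on at most one common line; $k\ge3$. Its point graph has the points as vertices, two distinct points adjacent iff they lie on a common line. A strongly regular configuration with parameters $(v_k;\lambda,\mu)$ is a symmetric $(v_k)$ configuration whose point graph is a strongly regular graph $SRG(v,k(k-1),\lambda,\mu)$.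 *)

theory Defs
  imports "HOL-Algebra.Group_Action"
begin

section \<open>Incidence structures and strongly regular configurations\<close>

text \<open>Lines need not be sets of points. Only the values of \<open>incident\<close> on points and lines of
  the structure are relevant.\<close>

record ('p, 'l) incidence_structure =
  points :: "'p set"
  lines :: "'l set"
  incident :: "'p \<Rightarrow> 'l \<Rightarrow> bool"

text \<open>\<open>v > 0\<close> excludes the structure without points and lines, which would otherwise satisfy
  every condition for \<open>v = 0\<close> vacuously.\<close>

definition symmetric_configuration :: "('p, 'l) incidence_structure \<Rightarrow> nat \<Rightarrow> nat \<Rightarrow> bool" where
  "symmetric_configuration S v k \<longleftrightarrow>
     v > 0 \<and> k \<ge> 3 \<and>
     finite (points S) \<and> card (points S) = v \<and>
     finite (lines S) \<and> card (lines S) = v \<and>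
     (\<forall>l \<in> lines S. card {p \<in> points S. incident S p l} = k) \<and>
     (\<forall>p \<in> points S. card {l \<in> lines S. incident S p l} = k) \<and>
     (\<forall>p \<in> points S. \<forall>q \<in> points S. \<forall>l \<in> lines S. \<forall>m \<in> lines S.
        p \<noteq> q \<and> incident S p l \<and> incident S q l \<and> incident S p m \<and> incident S q m \<longrightarrow> l = m)"

definition collinear :: "('p, 'l) incidence_structure \<Rightarrow> 'p \<Rightarrow> 'p \<Rightarrow> bool" where
  "collinear S p q \<longleftrightarrow> p \<noteq> q \<and> (\<exists>l \<in> lines S. incident S p l \<and> incident S q l)"

text \<open>Complete graphs are not excluded; for them the condition on \<open>mu\<close> is vacuous. They occur as
  point graphs of projective planes.\<close>

definition strongly_regular_graph ::
    "'a set \<Rightarrow> ('a \<Rightarrow> 'a \<Rightarrow> bool) \<Rightarrow> nat \<Rightarrow> nat \<Rightarrow> nat \<Rightarrow> nat \<Rightarrow> bool" where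
  "strongly_regular_graph V adj v d lam mu \<longleftrightarrow>
     finite V \<and> card V = v \<and>
     (\<forall>x \<in> V. \<not> adj x x) \<and>
     (\<forall>x \<in> V. \<forall>y \<in> V. adj x y \<longrightarrow> adj y x) \<and>
     (\<forall>x \<in> V. card {y \<in> V. adj x y} = d) \<and>
     (\<forall>x \<in> V. \<forall>y \<in> V. adj x y \<longrightarrow> card {z \<in> V. adj x z \<and> adj y z} = lam) \<and>
     (\<forall>x \<in> V. \<forall>y \<in> V. x \<noteq> y \<and> \<not> adj x y \<longrightarrow> card {z \<in> V. adj x z \<and> adj y z} = mu)"

definition strongly_regular_configuration ::
    "('p, 'l) incidence_structure \<Rightarrow> nat \<Rightarrow> nat \<Rightarrow> nat \<Rightarrow> nat \<Rightarrow> bool" where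
  "strongly_regular_configuration S v k lam mu \<longleftrightarrow>
     symmetric_configuration S v k \<and>
     strongly_regular_graph (points S) (collinear S) v (k * (k - 1)) lam mu"

section \<open>Automorphisms and isomorphisms\<close>

text \<open>An automorphism is a pair of bijections, on the points and on the lines. The group operation
  is componentwise composition.\<close>

definition aut_group ::
    "('p, 'l) incidence_structure \<Rightarrow> (('p \<Rightarrow> 'p) \<times> ('l \<Rightarrow> 'l)) monoid" where
  "aut_group S = (BijGroup (points S) \<times>\<times> BijGroup (lines S))
     \<lparr>carrier := {(\<alpha>, \<beta>). \<alpha> \<in> Bij (points S) \<and> \<beta> \<in> Bij (lines S) \<and>
        (\<forall>p \<in> points S. \<forall>l \<in> lines S. incident S (\<alpha> p) (\<beta> l) \<longleftrightarrow> incident S p l)}\<rparr>"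

definition regular_action :: "('g, 'b) monoid_scheme \<Rightarrow> 'a set \<Rightarrow> ('g \<Rightarrow> 'a \<Rightarrow> 'a) \<Rightarrow> bool" where
  "regular_action G E \<phi> \<longleftrightarrow>
     transitive_action G E \<phi> \<and> (\<forall>x \<in> E. stabilizer G \<phi> x = {\<one>\<^bsub>G\<^esub>})"

text \<open>\<open>G\<close> is an automorphism group of \<open>S\<close> by means of the embedding \<open>\<rho>\<close> of \<open>G\<close> into the full
  automorphism group, and it is regular on points and on lines.\<close>

definition regular_automorphism_group ::
    "('g, 'b) monoid_scheme \<Rightarrow> ('p, 'l) incidence_structure \<Rightarrow>
     ('g \<Rightarrow> ('p \<Rightarrow> 'p) \<times> ('l \<Rightarrow> 'l)) \<Rightarrow> bool" where
  "regular_automorphism_group G S \<rho> \<longleftrightarrow>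
     \<rho> \<in> mon G (aut_group S) \<and>
     regular_action G (points S) (\<lambda>g. fst (\<rho> g)) \<and>
     regular_action G (lines S) (\<lambda>g. snd (\<rho> g))"

definition incidence_isomorphism ::
    "('p, 'l) incidence_structure \<Rightarrow> ('q, 'm) incidence_structure \<Rightarrow>
     ('p \<Rightarrow> 'q) \<Rightarrow> ('l \<Rightarrow> 'm) \<Rightarrow> bool" where
  "incidence_isomorphism S T f h \<longleftrightarrow>
     bij_betw f (points S) (points T) \<and> bij_betw h (lines S) (lines T) \<and>
     (\<forall>p \<in> points S. \<forall>l \<in> lines S. incident T (f p) (h l) \<longleftrightarrow> incident S p l)"

section \<open>Strong deficient difference sets\<close>

definition deficient_difference_set ::
    "('g, 'b) monoid_scheme \<Rightarrow> 'g set \<Rightarrow> nat \<Rightarrow> bool" where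
  "deficient_difference_set G D k \<longleftrightarrow>
     D \<subseteq> carrier G \<and> finite D \<and> card D = k \<and>
     inj_on (\<lambda>(d1, d2). inv\<^bsub>G\<^esub> d1 \<otimes>\<^bsub>G\<^esub> d2) {(d1, d2). d1 \<in> D \<and> d2 \<in> D \<and> d1 \<noteq> d2}"

definition left_differences :: "('g, 'b) monoid_scheme \<Rightarrow> 'g set \<Rightarrow> 'g set" where
  "left_differences G D = {inv\<^bsub>G\<^esub> d1 \<otimes>\<^bsub>G\<^esub> d2 | d1 d2. d1 \<in> D \<and> d2 \<in> D \<and> d1 \<noteq> d2}"

definition difference_overlap :: "('g, 'b) monoid_scheme \<Rightarrow> 'g set \<Rightarrow> 'g \<Rightarrow> nat" where
  "difference_overlap G D x =
     card (left_differences G D \<inter> (x <#\<^bsub>G\<^esub> left_differences G D))"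

definition strong_deficient_difference_set ::
    "('g, 'b) monoid_scheme \<Rightarrow> 'g set \<Rightarrow> nat \<Rightarrow> nat \<Rightarrow> nat \<Rightarrow> nat \<Rightarrow> bool" where
  "strong_deficient_difference_set G D v k lam mu \<longleftrightarrow>
     finite (carrier G) \<and> order G = v \<and> deficient_difference_set G D k \<and>
     (\<forall>x \<in> left_differences G D. difference_overlap G D x = lam) \<and>
     (\<forall>x \<in> carrier G - (left_differences G D \<union> {\<one>\<^bsub>G\<^esub>}). difference_overlap G D x = mu)"

section \<open>Development and left translations\<close>

definition dev :: "('g, 'b) monoid_scheme \<Rightarrow> 'g set \<Rightarrow> 'g set set" where
  "dev G D = {g <#\<^bsub>G\<^esub> D | g. g \<in> carrier G}"

definition dev_structure :: "('g, 'b) monoid_scheme \<Rightarrow> 'g set \<Rightarrow> ('g, 'g set) incidence_structure"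
  where "dev_structure G D = \<lparr>points = carrier G, lines = dev G D, incident = (\<in>)\<rparr>"

definition left_translation ::
    "('g, 'b) monoid_scheme \<Rightarrow> 'g set \<Rightarrow> 'g \<Rightarrow> ('g \<Rightarrow> 'g) \<times> ('g set \<Rightarrow> 'g set)" where
  "left_translation G D g =
     (\<lambda>x \<in> carrier G. g \<otimes>\<^bsub>G\<^esub> x, \<lambda>B \<in> dev G D. g <#\<^bsub>G\<^esub> B)"

text \<open>\<open>S\<close> with its group action \<open>\<rho>\<close> is the development of \<open>D\<close> with the action of \<open>G\<close> by left
  translations, up to an isomorphism compatible with the two actions.\<close>

definition obtained_from ::
    "('g, 'b) monoid_scheme \<Rightarrow> 'g set \<Rightarrow> ('p, 'l) incidence_structure \<Rightarrow>
     ('g \<Rightarrow> ('p \<Rightarrow> 'p) \<times> ('l \<Rightarrow> 'l)) \<Rightarrow> bool" where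
  "obtained_from G D S \<rho> \<longleftrightarrow>
     (\<exists>f h. incidence_isomorphism (dev_structure G D) S f h \<and>
        (\<forall>g \<in> carrier G.
           (\<forall>x \<in> carrier G. f (fst (left_translation G D g) x) = fst (\<rho> g) (f x)) \<and>
           (\<forall>B \<in> dev G D. h (snd (left_translation G D g) B) = snd (\<rho> g) (h B))))"

end

theory Submission
  imports Defs
begin

text \<open>Two points \<open>x \<noteq> y\<close> of the development lie on \<open>gD\<close> iff \<open>x\<^sup>-\<^sup>1y = d\<^sub>1\<^sup>-\<^sup>1d\<^sub>2\<close> for
  \<open>d\<^sub>1 = g\<^sup>-\<^sup>1x\<close> and \<open>d\<^sub>2 = g\<^sup>-\<^sup>1y\<close> in \<open>D\<close>. Hence distinctness of the differences says
  that two points determine at most one line, the point graph is the Cayley graph of \<open>\<Delta>(D)\<close>, and the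
  common neighbours of \<open>x\<close> and \<open>y\<close> correspond to \<open>\<Delta>(D) \<inter> x\<^sup>-\<^sup>1y\<Delta>(D)\<close>. For the converse, fix a
  point \<open>p\<close> and a line \<open>l\<close>, and let \<open>D\<close> consist of all \<open>g\<close> such that \<open>gp\<close> is on \<open>l\<close>; then
  \<open>x \<mapsto> xp\<close>, \<open>gD \<mapsto> gl\<close> is an isomorphism from the development of \<open>D\<close>.\<close>

section \<open>Cancellation of inverses in a group\<close>

lemma (in group) inv_mult_cancel_left [simp]:
  assumes "x \<in> carrier G" "y \<in> carrier G"
  shows "inv x \<otimes> (x \<otimes> y) = y" "x \<otimes> (inv x \<otimes> y) = y"
  using assms by (simp_all add: m_assoc[symmetric])

lemma (in group) inv_mult_eq_one_iff:
  assumes "x \<in> carrier G" "y \<in> carrier G"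
  shows "inv x \<otimes> y = \<one> \<longleftrightarrow> x = y"
  using assms by (metis inv_mult_cancel_left(2) l_inv r_one)

section \<open>Regular actions\<close>

text \<open>Pointwise laws suffice: \<open>\<phi> (inv g)\<close> undoes \<open>\<phi> g\<close> on
  both sides, which gives bijectivity. Extensionality turns the pointwise product law into an
  equality of functions, as a homomorphism into \<open>BijGroup E\<close> requires.\<close>

lemma group_actionI:
  assumes "group G"
    and ext: "\<And>g. g \<in> carrier G \<Longrightarrow> \<phi> g \<in> extensional E"
    and into: "\<And>g x. g \<in> carrier G \<Longrightarrow> x \<in> E \<Longrightarrow> \<phi> g x \<in> E"
    and one: "\<And>x. x \<in> E \<Longrightarrow> \<phi> \<one>\<^bsub>G\<^esub> x = x"
    and mult: "\<And>g h x. g \<in> carrier G \<Longrightarrow> h \<in> carrier G \<Longrightarrow> x \<in> E \<Longrightarrow>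
      \<phi> (g \<otimes>\<^bsub>G\<^esub> h) x = \<phi> g (\<phi> h x)"
  shows "group_action G E \<phi>"
proof -
  interpret group G by fact
  have Bij: "\<phi> g \<in> Bij E" if g: "g \<in> carrier G" for g
  proof -
    have "\<phi> (inv\<^bsub>G\<^esub> g) (\<phi> g x) = x" "\<phi> g (\<phi> (inv\<^bsub>G\<^esub> g) x) = x" if "x \<in> E" for x
      using mult[of "inv\<^bsub>G\<^esub> g" g x] mult[of g "inv\<^bsub>G\<^esub> g" x] g that one by auto
    then have "bij_betw (\<phi> g) E E"
      by (intro bij_betw_byWitness[where f' = "\<phi> (inv\<^bsub>G\<^esub> g)"]) (use into g in auto)
    then show ?thesis
      using ext g by (simp add: Bij_def)
  qed
  have "\<phi> (g \<otimes>\<^bsub>G\<^esub> h) = compose E (\<phi> g) (\<phi> h)" if "g \<in> carrier G" "h \<in> carrier G" for g h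
    using that by (intro extensionalityI[of _ E]) (auto simp: ext mult compose_eq)
  then have "\<phi> \<in> hom G (BijGroup E)"
    by (intro homI) (auto simp: BijGroup_def Bij)
  then show ?thesis
    by (simp add: group_action_def group_hom_def group_hom_axioms_def group_BijGroup assms(1))
qed

text \<open>Transitivity gives surjectivity. If \<open>g\<close> and \<open>h\<close> agree at
  \<open>x\<close>, then \<open>inv h \<otimes> g\<close> lies in the trivial stabilizer of
  \<open>x\<close>. After the choice of a base point and a base line, this identifies both points
  and lines with group elements.\<close>

lemma regular_action_bij_betw:
  assumes "regular_action G E \<phi>" "x \<in> E"
  shows "bij_betw (\<lambda>g. \<phi> g x) (carrier G) E"
proof -
  interpret transitive_action G E \<phi>
    using assms(1) by (simp add: regular_action_def)
  interpret group G
    using group_hom by (simp add: group_hom_def)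
  have "g = h" if gh: "g \<in> carrier G" "h \<in> carrier G" "\<phi> g x = \<phi> h x" for g h
  proof -
    have "\<phi> (inv\<^bsub>G\<^esub> h \<otimes>\<^bsub>G\<^esub> g) x = x"
      using gh assms(2) by (simp add: composition_rule orbit_sym_aux)
    then have "inv\<^bsub>G\<^esub> h \<otimes>\<^bsub>G\<^esub> g \<in> stabilizer G \<phi> x"
      using gh by (simp add: stabilizer_def)
    then have "inv\<^bsub>G\<^esub> h \<otimes>\<^bsub>G\<^esub> g = \<one>\<^bsub>G\<^esub>"
      using assms by (simp add: regular_action_def)
    then show ?thesis
      using gh by (simp add: inv_mult_eq_one_iff)
  qed
  moreover have "(\<lambda>g. \<phi> g x) ` carrier G = E"
    using unique_orbit[OF assms(2)] element_image[OF _ assms(2) refl] by force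
  ultimately show ?thesis
    by (auto simp: bij_betw_def inj_on_def)
qed

text \<open>Products in \<open>aut_group S\<close> are componentwise, so the homomorphism law splits
  into one law on points and one on lines; preservation of incidence places the images in the
  carrier.\<close>

lemma hom_aut_groupI:
  assumes "group_action G (points S) (\<lambda>g. fst (\<rho> g))" "group_action G (lines S) (\<lambda>g. snd (\<rho> g))"
    and "\<And>g p l. g \<in> carrier G \<Longrightarrow> p \<in> points S \<Longrightarrow> l \<in> lines S \<Longrightarrow>
      incident S (fst (\<rho> g) p) (snd (\<rho> g) l) \<longleftrightarrow> incident S p l"
  shows "\<rho> \<in> hom G (aut_group S)"
proof -
  interpret P: group_action G "points S" "\<lambda>g. fst (\<rho> g)" by fact
  interpret L: group_action G "lines S" "\<lambda>g. snd (\<rho> g)" by fact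
  show ?thesis
  proof (rule homI)
    fix g assume "g \<in> carrier G"
    then show "\<rho> g \<in> carrier (aut_group S)"
      using P.bij_prop0 L.bij_prop0 assms(3) by (auto simp: aut_group_def case_prod_beta)
  next
    fix g h assume "g \<in> carrier G" "h \<in> carrier G"
    then show "\<rho> (g \<otimes>\<^bsub>G\<^esub> h) = \<rho> g \<otimes>\<^bsub>aut_group S\<^esub> \<rho> h"
      using group_hom.hom_mult[OF P.group_hom] group_hom.hom_mult[OF L.group_hom]
      by (simp add: aut_group_def DirProd_def case_prod_beta prod_eq_iff)
  qed
qed

section \<open>The development of a set\<close>

lemma (in group) mem_l_coset_iff:
  assumes "D \<subseteq> carrier G" "g \<in> carrier G" "x \<in> carrier G"
  shows "x \<in> g <# D \<longleftrightarrow> inv g \<otimes> x \<in> D"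
proof
  assume "x \<in> g <# D"
  then obtain d where "d \<in> D" "x = g \<otimes> d"
    by (auto simp: l_coset_def)
  then show "inv g \<otimes> x \<in> D"
    using assms by (auto simp: subset_iff)
next
  assume "inv g \<otimes> x \<in> D"
  moreover have "x = g \<otimes> (inv g \<otimes> x)"
    using assms by simp
  ultimately show "x \<in> g <# D"
    unfolding l_coset_def by blast
qed

lemma (in group) card_l_coset:
  assumes "A \<subseteq> carrier G" "x \<in> carrier G"
  shows "card (x <# A) = card A"
proof -
  have "inj_on (\<lambda>a. x \<otimes> a) A"
    using assms by (intro inj_onI) (metis inv_mult_cancel_left(1) subsetD)
  then show ?thesis
    by (simp add: l_coset_def image_def[symmetric] UNION_singleton_eq_range card_image)
qed

section \<open>Differences and the lines through two points\<close>

lemma (in group) left_differences_subset: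
  "D \<subseteq> carrier G \<Longrightarrow> left_differences G D \<subseteq> carrier G - {\<one>}"
  by (auto simp: left_differences_def inv_mult_eq_one_iff subset_iff)

text \<open>Deficiency makes the difference map injective on ordered pairs of distinct elements, so
  counting differences is counting pairs. The number obtained is the valency of the point
  graph.\<close>

lemma (in group) card_left_differences:
  assumes "deficient_difference_set G D k"
  shows "card (left_differences G D) = k * (k - 1)"
proof -
  let ?P = "{(d1, d2). d1 \<in> D \<and> d2 \<in> D \<and> d1 \<noteq> d2}"
  have D: "finite D" "card D = k"
    using assms by (auto simp: deficient_difference_set_def)
  have "?P = (SIGMA d:D. D - {d})"
    by auto
  then have "card ?P = (\<Sum>d\<in>D. card (D - {d}))"
    using D(1) by simp
  also have "\<dots> = k * (k - 1)"
    using D by simp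
  finally have "card ?P = k * (k - 1)" .
  moreover have "left_differences G D = (\<lambda>(d1, d2). inv d1 \<otimes> d2) ` ?P"
    by (auto simp: left_differences_def)
  ultimately show ?thesis
    using assms by (simp add: deficient_difference_set_def card_image)
qed

text \<open>The defining injectivity speaks of pairs of distinct elements only. Here
  \<open>d3 \<noteq> d4\<close> is automatic, since otherwise the common difference would be
  \<open>\<one>\<close>, forcing \<open>d1 = d2\<close>.\<close>

lemma (in group) deficient_difference_setD:
  assumes "deficient_difference_set G D k"
    and "d1 \<in> D" "d2 \<in> D" "d3 \<in> D" "d4 \<in> D" "d1 \<noteq> d2"
    and eq: "inv d1 \<otimes> d2 = inv d3 \<otimes> d4"
  shows "d1 = d3 \<and> d2 = d4"
proof -
  have D: "D \<subseteq> carrier G" and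
    inj: "inj_on (\<lambda>(d1, d2). inv d1 \<otimes> d2) {(d1, d2). d1 \<in> D \<and> d2 \<in> D \<and> d1 \<noteq> d2}"
    using assms(1) by (auto simp: deficient_difference_set_def)
  have "d3 \<noteq> d4"
    using assms(2-7) D by (metis inv_mult_eq_one_iff subsetD)
  then show ?thesis
    using inj_onD[OF inj, of "(d1, d2)" "(d3, d4)"] assms by auto
qed

text \<open>Writing \<open>x = g \<otimes> a\<close> and \<open>y = g \<otimes> b\<close>, the
  quotient \<open>inv x \<otimes> y\<close> equals \<open>inv a \<otimes> b\<close>, free of
  \<open>g\<close>. Both lines therefore yield the same difference, so \<open>x\<close> corresponds
  to the same element of \<open>D\<close> on both, and cancelling it gives
  \<open>g = h\<close>.\<close>

lemma (in group) line_through_two_points_unique: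
  assumes D: "deficient_difference_set G D k" and "g \<in> carrier G" "h \<in> carrier G"
    and "x \<in> g <# D" "y \<in> g <# D" "x \<in> h <# D" "y \<in> h <# D" "x \<noteq> y"
  shows "g = h"
proof -
  have sub: "D \<subseteq> carrier G"
    using D by (simp add: deficient_difference_set_def)
  obtain a b c d where abcd: "a \<in> D" "b \<in> D" "c \<in> D" "d \<in> D"
      "x = g \<otimes> a" "y = g \<otimes> b" "x = h \<otimes> c" "y = h \<otimes> d"
    using assms by (auto simp: l_coset_def)
  have carr: "a \<in> carrier G" "b \<in> carrier G" "c \<in> carrier G" "d \<in> carrier G"
    using abcd sub by auto
  have quotient: "inv (e \<otimes> r) \<otimes> (e \<otimes> s) = inv r \<otimes> s"
    if "e \<in> carrier G" "r \<in> carrier G" "s \<in> carrier G" for e r s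
    using that by (simp add: inv_mult_group m_assoc)
  have "inv a \<otimes> b = inv x \<otimes> y" "inv c \<otimes> d = inv x \<otimes> y"
    using quotient[of g a b] quotient[of h c d] assms(2,3) carr abcd by simp_all
  then have "a = c"
    using deficient_difference_setD[OF D, of a b c d] abcd \<open>x \<noteq> y\<close> by auto
  then show ?thesis
    using abcd assms(2,3) carr by auto
qed

text \<open>Two distinct elements of \<open>D\<close> give two points shared by equal translates, so
  uniqueness of the joining line applies. Lines are thereby indexed by group elements without
  repetition.\<close>

lemma (in group) bij_betw_dev:
  assumes D: "deficient_difference_set G D k" and "k \<ge> 2"
  shows "bij_betw (\<lambda>g. g <# D) (carrier G) (dev G D)"
proof -
  have sub: "D \<subseteq> carrier G" and "card D \<ge> 2"
    using assms by (auto simp: deficient_difference_set_def)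
  then obtain a b where ab: "a \<in> D" "b \<in> D" "a \<noteq> b"
    by (metis card_2_iff' obtain_subset_with_card_n subsetD)
  have "g = h" if gh: "g \<in> carrier G" "h \<in> carrier G" "g <# D = h <# D" for g h
  proof (rule line_through_two_points_unique[OF D gh(1,2)])
    show "g \<otimes> a \<in> g <# D" "g \<otimes> b \<in> g <# D"
      using ab by (auto simp: l_coset_def)
    then show "g \<otimes> a \<in> h <# D" "g \<otimes> b \<in> h <# D"
      using gh(3) by auto
    show "g \<otimes> a \<noteq> g \<otimes> b"
      using ab sub gh(1) by (metis inv_mult_cancel_left(1) subsetD)
  qed
  then show ?thesis
    by (auto simp: bij_betw_def inj_on_def dev_def)
qed

section \<open>The point graph\<close>

text \<open>Formulated for any \<open>S\<close> isomorphic to the development, so that the same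
  computation serves the development itself and, in the converse, the given configuration.\<close>

lemma (in group) collinear_iff_left_differences:
  assumes D: "D \<subseteq> carrier G" and iso: "incidence_isomorphism (dev_structure G D) S f h"
    and x: "x \<in> carrier G" and y: "y \<in> carrier G"
  shows "collinear S (f x) (f y) \<longleftrightarrow> inv x \<otimes> y \<in> left_differences G D"
proof -
  have f: "bij_betw f (carrier G) (points S)" and h: "h ` dev G D = lines S"
    and inc: "\<And>p B. p \<in> carrier G \<Longrightarrow> B \<in> dev G D \<Longrightarrow> incident S (f p) (h B) \<longleftrightarrow> p \<in> B"
    using iso by (auto simp: incidence_isomorphism_def dev_structure_def bij_betw_def)
  have "f x = f y \<longleftrightarrow> x = y"
    using f x y by (auto simp: bij_betw_def inj_on_def)
  then have "collinear S (f x) (f y) \<longleftrightarrow> x \<noteq> y \<and> (\<exists>B \<in> dev G D. x \<in> B \<and> y \<in> B)"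
    using inc x y by (auto simp: collinear_def h[symmetric])
  also have "\<dots> \<longleftrightarrow> x \<noteq> y \<and> (\<exists>g \<in> carrier G. inv g \<otimes> x \<in> D \<and> inv g \<otimes> y \<in> D)"
    using mem_l_coset_iff[OF D] x y by (auto simp: dev_def)
  also have "\<dots> \<longleftrightarrow> inv x \<otimes> y \<in> left_differences G D"
  proof safe
    fix g assume g: "g \<in> carrier G" "inv g \<otimes> x \<in> D" "inv g \<otimes> y \<in> D" and "x \<noteq> y"
    have "inv x \<otimes> y = inv (inv g \<otimes> x) \<otimes> (inv g \<otimes> y)"
      using g(1) x y by (simp add: inv_mult_group m_assoc)
    moreover have "inv g \<otimes> x \<noteq> inv g \<otimes> y"
      using g(1) x y \<open>x \<noteq> y\<close> by simp
    ultimately show "inv x \<otimes> y \<in> left_differences G D"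
      using g unfolding left_differences_def by blast
  next
    assume "inv x \<otimes> y \<in> left_differences G D"
    then obtain a b where ab: "a \<in> D" "b \<in> D" "inv x \<otimes> y = inv a \<otimes> b"
      by (auto simp: left_differences_def)
    then have "a \<in> carrier G" "b \<in> carrier G"
      using D by auto
    \<comment> \<open>The translate sought must have \<open>x\<close> in the position of
      \<open>a\<close>: solving \<open>inv g \<otimes> x = a\<close> for \<open>g\<close> gives this
      witness, and the equality of differences then puts \<open>y\<close> in the position of
      \<open>b\<close>.\<close>
    let ?g = "x \<otimes> inv a"
    have "inv ?g \<otimes> x = a"
      using \<open>a \<in> carrier G\<close> x by (simp add: inv_mult_group m_assoc)
    moreover have "inv ?g \<otimes> y = b"
      using \<open>a \<in> carrier G\<close> \<open>b \<in> carrier G\<close> x y ab(3)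
      by (simp add: inv_mult_group m_assoc ab(3))
    ultimately show "\<exists>g \<in> carrier G. inv g \<otimes> x \<in> D \<and> inv g \<otimes> y \<in> D"
      using ab x \<open>a \<in> carrier G\<close> by (intro bexI[of _ ?g]) auto
  next
    \<comment> \<open>This is the case \<open>x = y\<close>, excluded because \<open>\<one>\<close>
      is not a left difference.\<close>
    assume "inv y \<otimes> y \<in> left_differences G D"
    then show False
      using left_differences_subset[OF D] y by auto
  qed
  finally show ?thesis .
qed

lemma (in group) card_neighbours:
  assumes D: "D \<subseteq> carrier G" and iso: "incidence_isomorphism (dev_structure G D) S f h"
    and x: "x \<in> carrier G"
  shows "card {q \<in> points S. collinear S (f x) q} = card (left_differences G D)"
proof -
  have f: "bij_betw f (carrier G) (points S)"
    using iso by (auto simp: incidence_isomorphism_def dev_structure_def)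
  have sub: "left_differences G D \<subseteq> carrier G"
    using left_differences_subset[OF D] by auto
  then have sub': "x <# left_differences G D \<subseteq> carrier G"
    using x l_coset_subset_G by blast
  have "{q \<in> points S. collinear S (f x) q} = f ` (x <# left_differences G D)"
    using collinear_iff_left_differences[OF D iso x] mem_l_coset_iff[OF sub x] sub'
    unfolding bij_betw_imp_surj_on[OF f, symmetric] by auto
  moreover have "inj_on f (x <# left_differences G D)"
    using f sub' by (meson bij_betw_imp_inj_on inj_on_subset)
  ultimately show ?thesis
    using card_l_coset[OF sub x] by (simp add: card_image)
qed

text \<open>A point \<open>z\<close> is a common neighbour iff \<open>inv x \<otimes> z\<close> and
  \<open>inv y \<otimes> z\<close> are both differences. The second condition says that
  \<open>inv x \<otimes> z\<close> lies in the translate of the differences by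
  \<open>inv x \<otimes> y\<close>, so the common neighbours form the \<open>x\<close>-translate of
  the overlap.\<close>

lemma (in group) card_common_neighbours:
  assumes D: "D \<subseteq> carrier G" and iso: "incidence_isomorphism (dev_structure G D) S f h"
    and x: "x \<in> carrier G" and y: "y \<in> carrier G"
  shows "card {q \<in> points S. collinear S (f x) q \<and> collinear S (f y) q} =
    difference_overlap G D (inv x \<otimes> y)"
proof -
  let ?\<Delta> = "left_differences G D"
  let ?A = "?\<Delta> \<inter> ((inv x \<otimes> y) <# ?\<Delta>)"
  have f: "bij_betw f (carrier G) (points S)"
    using iso by (auto simp: incidence_isomorphism_def dev_structure_def)
  have sub: "?\<Delta> \<subseteq> carrier G"
    using left_differences_subset[OF D] by auto
  have A: "?A \<subseteq> carrier G" and sub': "x <# ?A \<subseteq> carrier G"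
    using sub x l_coset_subset_G[of ?A x] by auto
  have "z \<in> x <# ?A \<longleftrightarrow> collinear S (f x) (f z) \<and> collinear S (f y) (f z)"
    if z: "z \<in> carrier G" for z
  proof -
    have "inv (inv x \<otimes> y) \<otimes> (inv x \<otimes> z) = inv y \<otimes> z"
      using x y z by (simp add: inv_mult_group m_assoc)
    then show ?thesis
      using x y z mem_l_coset_iff[OF A x z] mem_l_coset_iff[OF sub, of "inv x \<otimes> y" "inv x \<otimes> z"]
      by (simp add: collinear_iff_left_differences[OF D iso])
  qed
  then have "{q \<in> points S. collinear S (f x) q \<and> collinear S (f y) q} = f ` (x <# ?A)"
    using sub' unfolding bij_betw_imp_surj_on[OF f, symmetric] by auto
  moreover have "inj_on f (x <# ?A)"
    using f sub' by (meson bij_betw_imp_inj_on inj_on_subset)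
  ultimately show ?thesis
    using card_l_coset[OF A x] by (simp add: card_image difference_overlap_def)
qed

text \<open>Order, symmetry and valency of the point graph are already settled; what remains are the
  two counts of common neighbours, and these depend on \<open>inv x \<otimes> y\<close> alone. As an
  equivalence for any copy \<open>S\<close> of the development, it covers both directions of the
  theorem.\<close>

lemma (in group) strongly_regular_graph_iff_strong_deficient:
  assumes fin: "finite (carrier G)" and v: "order G = v" and D: "deficient_difference_set G D k"
    and iso: "incidence_isomorphism (dev_structure G D) S f h"
  shows "strongly_regular_graph (points S) (collinear S) v (k * (k - 1)) lam mu \<longleftrightarrow>
    strong_deficient_difference_set G D v k lam mu"
proof -
  let ?\<Delta> = "left_differences G D"
  have sub: "D \<subseteq> carrier G"
    using D by (simp add: deficient_difference_set_def)
  have f: "bij_betw f (carrier G) (points S)"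
    using iso by (auto simp: incidence_isomorphism_def dev_structure_def)
  have pts: "points S = f ` carrier G"
    using f by (simp add: bij_betw_imp_surj_on)
  have "finite (points S)" "card (points S) = v"
    using fin v bij_betw_same_card[OF f] by (auto simp: pts order_def)
  moreover have "\<not> collinear S p p" "collinear S p q \<longrightarrow> collinear S q p" for p q
    by (auto simp: collinear_def)
  moreover have "\<forall>p \<in> points S. card {q \<in> points S. collinear S p q} = k * (k - 1)"
    using card_neighbours[OF sub iso] card_left_differences[OF D] by (auto simp: pts)
  ultimately have "strongly_regular_graph (points S) (collinear S) v (k * (k - 1)) lam mu \<longleftrightarrow>
      (\<forall>p \<in> points S. \<forall>q \<in> points S.
        (collinear S p q \<longrightarrow> card {r \<in> points S. collinear S p r \<and> collinear S q r} = lam) \<and>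
        (p \<noteq> q \<and> \<not> collinear S p q \<longrightarrow>
          card {r \<in> points S. collinear S p r \<and> collinear S q r} = mu))"
    unfolding strongly_regular_graph_def by blast
  also have "\<dots> \<longleftrightarrow> (\<forall>x \<in> carrier G. \<forall>y \<in> carrier G.
        (collinear S (f x) (f y) \<longrightarrow>
          card {r \<in> points S. collinear S (f x) r \<and> collinear S (f y) r} = lam) \<and>
        (f x \<noteq> f y \<and> \<not> collinear S (f x) (f y) \<longrightarrow>
          card {r \<in> points S. collinear S (f x) r \<and> collinear S (f y) r} = mu))"
    by (simp add: pts)
  also have "\<dots> \<longleftrightarrow> (\<forall>x \<in> carrier G. \<forall>y \<in> carrier G.
        (inv x \<otimes> y \<in> ?\<Delta> \<longrightarrow> difference_overlap G D (inv x \<otimes> y) = lam) \<and>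
        (inv x \<otimes> y \<notin> ?\<Delta> \<and> inv x \<otimes> y \<noteq> \<one> \<longrightarrow> difference_overlap G D (inv x \<otimes> y) = mu))"
  proof -
    have "f x \<noteq> f y \<longleftrightarrow> inv x \<otimes> y \<noteq> \<one>" if "x \<in> carrier G" "y \<in> carrier G" for x y
    proof -
      have "f x = f y \<longleftrightarrow> x = y"
        using f that by (auto simp: bij_betw_def inj_on_def)
      moreover have "x = y \<longleftrightarrow> inv x \<otimes> y = \<one>"
        using that by (simp add: inv_mult_eq_one_iff)
      ultimately show ?thesis by simp
    qed
    then show ?thesis
      using collinear_iff_left_differences[OF sub iso] card_common_neighbours[OF sub iso]
      by (intro ball_cong) auto
  qed
  also have "\<dots> \<longleftrightarrow> (\<forall>z \<in> carrier G. (z \<in> ?\<Delta> \<longrightarrow> difference_overlap G D z = lam) \<and>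
        (z \<notin> ?\<Delta> \<and> z \<noteq> \<one> \<longrightarrow> difference_overlap G D z = mu))" (is "?L \<longleftrightarrow> ?R")
  proof
    assume ?L
    then show ?R
      \<comment> \<open>With \<open>x = \<one>\<close>, the quotient
        \<open>inv x \<otimes> y\<close> runs through all of the group.\<close>
      using bspec[OF \<open>?L\<close> one_closed] by simp
  qed simp
  also have "\<dots> \<longleftrightarrow> strong_deficient_difference_set G D v k lam mu"
    using left_differences_subset[OF sub] fin v D
    by (auto simp: strong_deficient_difference_set_def)
  finally show ?thesis .
qed

section \<open>The development as a configuration\<close>

lemma (in group) symmetric_configuration_dev:
  assumes fin: "finite (carrier G)" and v: "order G = v" and "k \<ge> 3"
    and D: "deficient_difference_set G D k"
  shows "symmetric_configuration (dev_structure G D) v k"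
proof -
  have sub: "D \<subseteq> carrier G" and cD: "card D = k"
    using D by (auto simp: deficient_difference_set_def)
  have bij: "bij_betw (\<lambda>g. g <# D) (carrier G) (dev G D)"
    using bij_betw_dev[OF D] \<open>k \<ge> 3\<close> by simp
  have "card {p \<in> carrier G. p \<in> B} = k" if B: "B \<in> dev G D" for B
  proof -
    obtain g where g: "g \<in> carrier G" "B = g <# D"
      using B by (auto simp: dev_def)
    then have "{p \<in> carrier G. p \<in> B} = g <# D"
      using l_coset_subset_G[OF sub g(1)] by auto
    then show ?thesis
      using card_l_coset[OF sub g(1)] cD by simp
  qed
  moreover have "card {B \<in> dev G D. p \<in> B} = k" if p: "p \<in> carrier G" for p
  proof -
    let ?P = "{g \<in> carrier G. inv g \<otimes> p \<in> D}"
    have "{B \<in> dev G D. p \<in> B} = (\<lambda>g. g <# D) ` ?P"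
      using mem_l_coset_iff[OF sub _ p] by (auto simp: dev_def)
    moreover have "inj_on (\<lambda>g. g <# D) ?P"
      using bij by (auto simp: bij_betw_def inj_on_def)
    \<comment> \<open>Solving \<open>inv g \<otimes> p = d\<close> for \<open>g\<close> gives
      \<open>p \<otimes> inv d\<close>: exactly one translate through \<open>p\<close> for each
      element of \<open>D\<close>.\<close>
    moreover have "bij_betw (\<lambda>g. inv g \<otimes> p) ?P D"
      using sub p
      by (intro bij_betw_byWitness[where f' = "\<lambda>d. p \<otimes> inv d"])
        (auto simp: inv_mult_group m_assoc subset_iff)
    ultimately show ?thesis
      using cD by (simp add: card_image bij_betw_same_card)
  qed
  moreover have "l = m" if "l \<in> dev G D" "m \<in> dev G D" "p \<in> l" "q \<in> l" "p \<in> m" "q \<in> m" "p \<noteq> q"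
    for p q l m
    using that line_through_two_points_unique[OF D] by (auto simp: dev_def)
  moreover have "finite (dev G D)" "card (dev G D) = v" "v > 0"
    using fin v bij_betw_same_card[OF bij] bij_betw_finite[OF bij] order_gt_0_iff_finite
    by (auto simp: order_def)
  ultimately show ?thesis
    using fin v \<open>k \<ge> 3\<close>
    by (simp add: symmetric_configuration_def dev_structure_def order_def) blast
qed

text \<open>On points, regularity is cancellation in the group. On lines it rests on the injectivity
  of \<open>g \<mapsto> g <# D\<close>: a translation fixing \<open>a <# D\<close> satisfies
  \<open>g \<otimes> a = a\<close>.\<close>

lemma (in group) regular_automorphism_group_dev:
  assumes D: "deficient_difference_set G D k" and "k \<ge> 2"
  shows "regular_automorphism_group G (dev_structure G D) (left_translation G D)"
proof -
  let ?S = "dev_structure G D" and ?\<rho> = "left_translation G D"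
  have sub: "D \<subseteq> carrier G"
    using D by (auto simp: deficient_difference_set_def)
  have bij: "bij_betw (\<lambda>g. g <# D) (carrier G) (dev G D)"
    using bij_betw_dev[OF assms] .
  have simps [simp]: "points ?S = carrier G" "lines ?S = dev G D" "incident ?S = (\<in>)"
    by (simp_all add: dev_structure_def)
  have fst_\<rho>: "fst (?\<rho> g) x = g \<otimes> x" if "x \<in> carrier G" for g x
    using that by (simp add: left_translation_def)
  have dev_mem: "g <# D \<in> dev G D" if "g \<in> carrier G" for g
    using that by (auto simp: dev_def)
  have snd_\<rho>: "snd (?\<rho> g) (a <# D) = (g \<otimes> a) <# D" if "g \<in> carrier G" "a \<in> carrier G" for g a
    using that sub dev_mem by (simp add: left_translation_def lcos_m_assoc)
  have points_action: "group_action G (carrier G) (\<lambda>g. fst (?\<rho> g))"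
    by (intro group_actionI is_group) (auto simp: fst_\<rho> m_assoc, simp add: left_translation_def)
  have lines_action: "group_action G (dev G D) (\<lambda>g. snd (?\<rho> g))"
  proof (intro group_actionI is_group)
    show "snd (?\<rho> g) \<in> extensional (dev G D)" for g
      by (simp add: left_translation_def)
  qed (auto simp: dev_def snd_\<rho> m_assoc)
  have points_regular: "regular_action G (carrier G) (\<lambda>g. fst (?\<rho> g))"
    unfolding regular_action_def transitive_action_def transitive_action_axioms_def
  proof (intro conjI allI impI ballI points_action)
    fix x y assume xy: "x \<in> carrier G" "y \<in> carrier G"
    then show "\<exists>g \<in> carrier G. fst (?\<rho> g) x = y"
      by (intro bexI[of _ "y \<otimes> inv x"]) (auto simp: fst_\<rho> m_assoc)
  qed (auto simp: stabilizer_def fst_\<rho>)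
  have lines_regular: "regular_action G (dev G D) (\<lambda>g. snd (?\<rho> g))"
    unfolding regular_action_def transitive_action_def transitive_action_axioms_def
  proof (intro conjI allI impI ballI lines_action)
    fix A B assume "A \<in> dev G D" "B \<in> dev G D"
    then obtain a b where ab: "a \<in> carrier G" "b \<in> carrier G" "A = a <# D" "B = b <# D"
      by (auto simp: dev_def)
    then show "\<exists>g \<in> carrier G. snd (?\<rho> g) A = B"
      by (intro bexI[of _ "b \<otimes> inv a"]) (auto simp: snd_\<rho> m_assoc)
  next
    fix A assume "A \<in> dev G D"
    then obtain a where a: "a \<in> carrier G" "A = a <# D"
      by (auto simp: dev_def)
    have "(g \<otimes> a) <# D = a <# D \<longleftrightarrow> g = \<one>" if "g \<in> carrier G" for g
      using inj_onD[OF bij_betw_imp_inj_on[OF bij], of "g \<otimes> a" a] a(1) that by auto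
    then show "stabilizer G (\<lambda>g. snd (?\<rho> g)) A = {\<one>}"
      using a by (auto simp: stabilizer_def snd_\<rho>)
  qed
  have "?\<rho> \<in> hom G (aut_group ?S)"
  proof (rule hom_aut_groupI)
    fix g p l assume g: "g \<in> carrier G" and "p \<in> points ?S" "l \<in> lines ?S"
    then obtain a where a: "a \<in> carrier G" "l = a <# D" and p: "p \<in> carrier G"
      by (auto simp: dev_def)
    \<comment> \<open>Whether \<open>p\<close> lies on \<open>a <# D\<close> is decided by
      \<open>inv a \<otimes> p\<close>, which a common left factor leaves unchanged.\<close>
    have "inv (g \<otimes> a) \<otimes> (g \<otimes> p) = inv a \<otimes> p"
      using a(1) g p by (simp add: inv_mult_group m_assoc)
    then show "incident ?S (fst (?\<rho> g) p) (snd (?\<rho> g) l) \<longleftrightarrow> incident ?S p l"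
      using a g p by (simp add: fst_\<rho> snd_\<rho> mem_l_coset_iff[OF sub])
  qed (use points_action lines_action in simp_all)
  moreover have "inj_on ?\<rho> (carrier G)"
  proof (rule inj_onI)
    fix g h assume "g \<in> carrier G" "h \<in> carrier G" "?\<rho> g = ?\<rho> h"
    then show "g = h"
      \<comment> \<open>A left translation is determined by the image of
        \<open>\<one>\<close>.\<close>
      using fst_\<rho>[OF one_closed] by (metis r_one)
  qed
  ultimately show ?thesis
    using points_regular lines_regular by (simp add: regular_automorphism_group_def mon_def)
qed

section \<open>Configurations with a regular automorphism group\<close>

text \<open>The isomorphism is listed besides \<open>obtained_from\<close> because the equivalence
  for the point graph takes it as input; strong regularity is brought in afterwards through that
  equivalence.\<close>

lemma (in group) regular_configuration_is_development:
  assumes conf: "symmetric_configuration S v k" and reg: "regular_automorphism_group G S \<rho>"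
  obtains D where "finite (carrier G)" "order G = v" "deficient_difference_set G D k"
    "\<exists>f h. incidence_isomorphism (dev_structure G D) S f h" "obtained_from G D S \<rho>"
proof -
  have fin: "finite (points S)" and cP: "card (points S) = v" and cL: "card (lines S) = v"
    and "v > 0" and "k \<ge> 3"
    and cl: "\<And>l. l \<in> lines S \<Longrightarrow> card {p \<in> points S. incident S p l} = k"
    and linear: "\<And>p q l m. p \<in> points S \<Longrightarrow> q \<in> points S \<Longrightarrow> l \<in> lines S \<Longrightarrow> m \<in> lines S \<Longrightarrow>
      p \<noteq> q \<Longrightarrow> incident S p l \<Longrightarrow> incident S q l \<Longrightarrow> incident S p m \<Longrightarrow> incident S q m \<Longrightarrow> l = m"
    using conf unfolding symmetric_configuration_def by blast+
  define \<alpha> where "\<alpha> g = fst (\<rho> g)" for g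
  define \<beta> where "\<beta> g = snd (\<rho> g)" for g
  have \<alpha>: "regular_action G (points S) \<alpha>" and \<beta>: "regular_action G (lines S) \<beta>"
    using reg unfolding regular_automorphism_group_def \<alpha>_def \<beta>_def by auto
  interpret P: group_action G "points S" \<alpha>
    using \<alpha> by (simp add: regular_action_def transitive_action_def)
  interpret L: group_action G "lines S" \<beta>
    using \<beta> by (simp add: regular_action_def transitive_action_def)
  have aut: "incident S (\<alpha> g p) (\<beta> g l) \<longleftrightarrow> incident S p l"
    if "g \<in> carrier G" "p \<in> points S" "l \<in> lines S" for g p l
  proof -
    have "\<rho> g \<in> carrier (aut_group S)"
      using reg that(1) by (auto simp: regular_automorphism_group_def mon_def hom_def)
    then show ?thesis
      using that by (auto simp: aut_group_def \<alpha>_def \<beta>_def)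
  qed
  \<comment> \<open>Any base point and base line will do, incident or not; \<open>v > 0\<close>
    guarantees that they exist.\<close>
  obtain p l where p: "p \<in> points S" and l: "l \<in> lines S"
    using cP cL \<open>v > 0\<close> by (metis card_gt_0_iff ex_in_conv)
  define f where "f x = \<alpha> x p" for x
  have f: "bij_betw f (carrier G) (points S)"
    unfolding f_def using regular_action_bij_betw[OF \<alpha> p] .
  have lines_bij: "bij_betw (\<lambda>g. \<beta> g l) (carrier G) (lines S)"
    using regular_action_bij_betw[OF \<beta> l] .
  have f_mem: "f x \<in> points S" if "x \<in> carrier G" for x
    using f that by (auto simp: bij_betw_def)
  have f_eq: "f x = f y \<longleftrightarrow> x = y" if "x \<in> carrier G" "y \<in> carrier G" for x y
    using f that by (auto simp: bij_betw_def inj_on_def)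
  have \<beta>_mem: "\<beta> g l \<in> lines S" if "g \<in> carrier G" for g
    using lines_bij that by (auto simp: bij_betw_def)
  have finG: "finite (carrier G)" and ordG: "order G = v"
    using f fin cP by (auto simp: bij_betw_finite bij_betw_same_card order_def)
  define D where "D = {x \<in> carrier G. incident S (f x) l}"
  have sub: "D \<subseteq> carrier G"
    by (auto simp: D_def)
  have f_mult: "f (g \<otimes> x) = \<alpha> g (f x)" if "g \<in> carrier G" "x \<in> carrier G" for g x
    using that p by (simp add: f_def P.composition_rule)
  have \<beta>_mult: "\<beta> (g \<otimes> x) l = \<beta> g (\<beta> x l)" if "g \<in> carrier G" "x \<in> carrier G" for g x
    using that l by (simp add: L.composition_rule)
  \<comment> \<open>Since \<open>f x\<close> is the image of \<open>f (inv g \<otimes> x)\<close>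
    under \<open>g\<close>, removing the automorphism \<open>g\<close> from both point and line
    leaves an incidence with \<open>l\<close>, which is membership in \<open>D\<close>.\<close>
  have inc: "incident S (f x) (\<beta> g l) \<longleftrightarrow> inv g \<otimes> x \<in> D"
    if "g \<in> carrier G" "x \<in> carrier G" for g x
  proof -
    have "f x = \<alpha> g (f (inv g \<otimes> x))"
      using that f_mult[of g "inv g \<otimes> x"] by simp
    then show ?thesis
      using that aut[of g "f (inv g \<otimes> x)" l] f_mem l by (auto simp: D_def)
  qed
  have D: "deficient_difference_set G D k"
    unfolding deficient_difference_set_def
  proof (intro conjI sub inj_onI)
    show "finite D"
      using sub finG by (rule finite_subset)
    have "{q \<in> points S. incident S q l} = f ` D"
      unfolding bij_betw_imp_surj_on[OF f, symmetric] by (auto simp: D_def)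
    moreover have "inj_on f D"
      using f sub by (meson bij_betw_imp_inj_on inj_on_subset)
    ultimately show "card D = k"
      using cl[OF l] by (simp add: card_image)
  next
    fix s t
    assume "s \<in> {(d1, d2). d1 \<in> D \<and> d2 \<in> D \<and> d1 \<noteq> d2}"
      and "t \<in> {(d1, d2). d1 \<in> D \<and> d2 \<in> D \<and> d1 \<noteq> d2}"
      and "(\<lambda>(d1, d2). inv d1 \<otimes> d2) s = (\<lambda>(d1, d2). inv d1 \<otimes> d2) t"
    then obtain a b c d where st: "s = (a, b)" "t = (c, d)"
      and abcd: "a \<in> D" "b \<in> D" "c \<in> D" "d \<in> D" "a \<noteq> b"
      and eq: "inv a \<otimes> b = inv c \<otimes> d"
      by auto
    have carr: "a \<in> carrier G" "b \<in> carrier G" "c \<in> carrier G" "d \<in> carrier G"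
      using abcd sub by auto
    \<comment> \<open>By \<open>inc\<close>, these identities place both points
      \<open>f \<one>\<close> and \<open>f (inv a \<otimes> b)\<close> on each of the lines
      \<open>\<beta> (inv a) l\<close> and \<open>\<beta> (inv c) l\<close>. As the points differ,
      the lines coincide, and regularity on lines yields \<open>a = c\<close>.\<close>
    have b: "a \<otimes> (inv a \<otimes> b) = b" and d: "c \<otimes> (inv a \<otimes> b) = d"
      using carr by (simp, simp add: eq)
    have "inv a \<otimes> b \<noteq> \<one>"
      using b carr abcd(5) by (metis r_one)
    then have "f \<one> \<noteq> f (inv a \<otimes> b)"
      using carr by (metis f_eq inv_closed m_closed one_closed)
    then have "\<beta> (inv a) l = \<beta> (inv c) l"
      by (intro linear[of "f \<one>" "f (inv a \<otimes> b)"]) (use carr abcd b d in \<open>simp_all add: f_mem \<beta>_mem inc\<close>)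
    then have "inv a = inv c"
      using lines_bij carr by (auto simp: bij_betw_def inj_on_def)
    then have "a = c"
      using carr by (metis inv_inv)
    then show "s = t"
      using b d st by simp
  qed
  \<comment> \<open>Each line of the development is \<open>g <# D\<close> for a unique
    \<open>g\<close>; \<open>h\<close> recovers this \<open>g\<close> and applies it to the base
    line.\<close>
  define h where "h B = \<beta> (the_inv_into (carrier G) (\<lambda>g. g <# D) B) l" for B
  have dev: "bij_betw (\<lambda>g. g <# D) (carrier G) (dev G D)"
    using bij_betw_dev[OF D] \<open>k \<ge> 3\<close> by simp
  have h: "h (g <# D) = \<beta> g l" if "g \<in> carrier G" for g
    using the_inv_into_f_f[OF bij_betw_imp_inj_on[OF dev] that] by (simp add: h_def)
  have "bij_betw h (dev G D) (lines S)"
    using bij_betw_trans[OF bij_betw_the_inv_into[OF dev] lines_bij]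
    by (simp add: h_def comp_def cong: bij_betw_cong)
  then have iso: "incidence_isomorphism (dev_structure G D) S f h"
    using f mem_l_coset_iff[OF sub]
    by (auto simp: incidence_isomorphism_def dev_structure_def dev_def h inc)
  have "f (fst (left_translation G D g) x) = fst (\<rho> g) (f x)"
    if "g \<in> carrier G" "x \<in> carrier G" for g x
    using that by (simp add: left_translation_def f_mult \<alpha>_def)
  moreover have "h (snd (left_translation G D g) B) = snd (\<rho> g) (h B)"
    if g: "g \<in> carrier G" and B: "B \<in> dev G D" for g B
  proof -
    obtain a where a: "a \<in> carrier G" "B = a <# D"
      using B by (auto simp: dev_def)
    have "snd (left_translation G D g) B = (g \<otimes> a) <# D"
      using B g a sub by (simp add: left_translation_def lcos_m_assoc)
    then show ?thesis
      using a g by (simp add: h \<beta>_mult) (simp add: \<beta>_def)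
  qed
  ultimately have "obtained_from G D S \<rho>"
    unfolding obtained_from_def using iso by blast
  then show thesis
    using that[OF finG ordG D] iso by blast
qed

section \<open>Difference sets correspond to configurations with a regular group\<close>

theorem theorem12:
  fixes G :: "('g, 'b) monoid_scheme"
    and D :: "'g set"
    and S :: "('p, 'l) incidence_structure"
    and \<rho> :: "'g \<Rightarrow> ('p \<Rightarrow> 'p) \<times> ('l \<Rightarrow> 'l)"
    and v k lam mu :: nat
  assumes "group G"
  shows "(finite (carrier G) \<and> k \<ge> 3 \<and> strong_deficient_difference_set G D v k lam mu \<longrightarrow>
            strongly_regular_configuration (dev_structure G D) v k lam mu \<and>
            regular_automorphism_group G (dev_structure G D) (left_translation G D)) \<and>
         (strongly_regular_configuration S v k lam mu \<and> regular_automorphism_group G S \<rho> \<longrightarrow>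
            (\<exists>D'. strong_deficient_difference_set G D' v k lam mu \<and> obtained_from G D' S \<rho>))"
proof -
  interpret group G by fact
  show ?thesis
  proof (intro conjI impI; elim conjE)
    assume fin: "finite (carrier G)" and "k \<ge> 3"
      and sdds: "strong_deficient_difference_set G D v k lam mu"
    then have D: "deficient_difference_set G D k" and v: "order G = v"
      by (auto simp: strong_deficient_difference_set_def)
    \<comment> \<open>The identity maps let the equivalence for copies apply to the development
      itself.\<close>
    have iso: "incidence_isomorphism (dev_structure G D) (dev_structure G D) (\<lambda>x. x) (\<lambda>B. B)"
      by (auto simp: incidence_isomorphism_def bij_betw_def)
    show "strongly_regular_configuration (dev_structure G D) v k lam mu"
      using iffD2[OF strongly_regular_graph_iff_strong_deficient[OF fin v D iso] sdds]
        symmetric_configuration_dev[OF fin v \<open>k \<ge> 3\<close> D]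
      by (simp only: strongly_regular_configuration_def)
    show "regular_automorphism_group G (dev_structure G D) (left_translation G D)"
      using regular_automorphism_group_dev[OF D] \<open>k \<ge> 3\<close> by simp
  next
    assume "strongly_regular_configuration S v k lam mu" and reg: "regular_automorphism_group G S \<rho>"
    then have conf: "symmetric_configuration S v k"
      and srg: "strongly_regular_graph (points S) (collinear S) v (k * (k - 1)) lam mu"
      by (auto simp: strongly_regular_configuration_def)
    obtain D' where "finite (carrier G)" "order G = v" "deficient_difference_set G D' k"
        "\<exists>f h. incidence_isomorphism (dev_structure G D') S f h" "obtained_from G D' S \<rho>"
      using regular_configuration_is_development[OF conf reg] .
    \<comment> \<open>The equivalence is applied to \<open>S\<close> as a copy of the development of
      \<open>D'\<close>, so the counts in the point graph of \<open>S\<close> translate directly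
      into overlaps of differences.\<close>
    then show "\<exists>D'. strong_deficient_difference_set G D' v k lam mu \<and> obtained_from G D' S \<rho>"
      using strongly_regular_graph_iff_strong_deficient srg by blast
  qed
qed

end
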